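(* Consider the nonlinear system of balance laws $\varepsilon\,\partial_t U+\partial_x F(U)=-R(U)/\varepsilon$ under the structural and entropy assumptions listed in the context. Then the associated limiting system $$\partial_t u = -\partial_x\big(Q A(\mathcal{E}(u))\,U_1\big),\qquad \text{where } U_1 \text{ is the unique solution of } \ B(\mathcal{E}(u))\,U_1=-\partial_x F(\mathcal{E}(u)),\quad QU_1=0,$$ takes the form $$\partial_t u = \partial_x\Big( S\,\mathcal{L}^{-1}(u)\,S^T\big(\partial_x D_u\Phi(\mathcal{E}(u))\big)^T\Big),$$ where $$S := Q A(\mathcal{E}(u)),\qquad \mathcal{L}(u) := D^2_U\Phi(\mathcal{E}(u))\,B(\mathcal{E}(u)),$$ and, for all $b\in\mathbb{R}^N$ with $Qb=0$, $\mathcal{L}^{-1}(u)\,b$ denotes the unique solution $V$ to the system $$\mathcal{L}(u)V=b,\qquad QV=0 .$$ In addition, this system is dissipative with respect to the entropy $\Phi$ in the sense that the following positivity condition holds for all $u$ in $\omega$: $$\big(\partial_x D_u\Phi(\mathcal{E}(u))\big)\, S\,\mathcal{L}^{-1}(u)\,S^T\,\big(\partial_x D_u\Phi(\mathcal{E}(u))\big)^T\ \ge\ 0 .$$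
   Context: Setting. Let $n<N$, let $\Omega\subset\mathbb{R}^N$ be a convex set, and let $F,R:\Omega\to\mathbb{R}^N$ be sufficiently regular. Consider, for $\varepsilon>0$, the system $\varepsilon\,\partial_t U+\partial_x F(U)=-R(U)/\varepsilon$, $t>0$, $x\in\mathbb{R}$, with unknown $U$ taking values in $\Omega$. Write $A:=D_UF$ and $B:=D_UR$ (the $N\times N$ Jacobian matrices). The associated homogeneous system is hyperbolic: $A$ admits real eigenvalues and a full basis of eigenvectors. Structural assumptions: (1) There is a constant $n\times N$ matrix $Q$ of (maximal) rank $n<N$ with $QR(U)=0$ for all $U\in\Omega$. Set $\omega:=Q\Omega\subset\mathbb{R}^n$. (2) There is a map $\mathcal{E}:\omega\to\Omega$ that uniquely determines the local equilibria, as defined by $Q\,\mathcal{E}(u)=u$ and $R(\mathcal{E}(u))=0$ for all $u\in\omega$. The equilibrium manifold is $\mathcal{M}:=\{U=\mathcal{E}(u)\}$. (3) $\dim\ker B(\mathcal{E}(u))=n$ and $\ker B(\mathcal{E}(u))\cap\operatorname{Im}B(\mathcal{E}(u))=\{0\}$. (4) $QF=0$ on $\mathcal{M}$, that is, $QF(\mathcal{E}(u))=0$ for $u\in\omega$. Entropy assumptions: there is a sufficiently regular entropy $\Phi:\Omega\to\mathbb{R}$ such that $D^2_U\Phi(U)A(U)$ is symmetric for all $U\in\Omega$, with an entropy-flux $\Psi:\Omega\to\mathbb{R}$ satisfying $D_U\Phi(U)A(U)=D_U\Psi(U)$ for $U\in\Omega$ (first derivatives are row vectors). The entropy $\Phi$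 is convex, in the sense that the $N\times N$ matrix $D^2_U\Phi(U)$ is required to be positive. Moreover, the entropy is compatible with the relaxation: (5) $D_U\Phi(U)R(U)\ge0$ for all $U\in\Omega$; (6) for some map $\nu:\mathcal{M}\to\mathbb{R}^n$ (row-vector valued), $D_U\Phi=\nu\,Q$ on $\mathcal{M}$. Here $D_u\Phi(\mathcal{E}(u))$ denotes the row-vector gradient with respect to $u$ of the function $u\mapsto\Phi(\mathcal{E}(u))$ on $\omega$. The limiting system is the one obtained formally as $\varepsilon\to0$ from the Chapman-Enskog-type expansion $U^\varepsilon=\mathcal{E}(u)+\varepsilon U_1+\varepsilon^2U_2+\cdots$ with $QU^\varepsilon=u$; it is the system displayed first in the claim.
   Formalization: The convex set Ω is taken open (dissipation can fail at boundary equilibria), and L^{-1}(u)b is not tied to Qb=0, where the system can be unsolvable: it is shown uniquely solvable exactly for b = D²Φ(E(u))c with Qc=0, and for every b = S^T w. *)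

theory Defs
  imports "HOL-Analysis.Analysis"
begin

text \<open>
  Row vectors such as \<open>D\<^sub>U\<Phi>\<close> are represented by elements of \<open>real^'N\<close>; a row vector times a matrix
  is then \<open>v*\<close>.  All derivatives in the state variables are taken on open sets, hence at \<open>at U\<close>.
\<close>

definition grad :: "(real^'k \<Rightarrow> real) \<Rightarrow> real^'k \<Rightarrow> real^'k" where
  "grad f x = (THE D. GDERIV f x :> D)"

definition hessian :: "(real^'k \<Rightarrow> real) \<Rightarrow> real^'k \<Rightarrow> real^'k^'k" where
  "hessian f x = jacobian (grad f) (at x)"

definition C1_on :: "(real^'k) set \<Rightarrow> (real^'k \<Rightarrow> real^'m) \<Rightarrow> bool" where
  "C1_on X f \<longleftrightarrow> (\<forall>x\<in>X. f differentiable (at x)) \<and> continuous_on X (\<lambda>x. jacobian f (at x))"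

definition has_real_eigenbasis :: "real^'N^'N \<Rightarrow> bool" where
  "has_real_eigenbasis M \<longleftrightarrow>
    (\<exists>X. independent X \<and> span X = UNIV \<and> (\<forall>V\<in>X. \<exists>l::real. M *v V = l *\<^sub>R V))"

text \<open>
  The solution \<open>V\<close> of \<open>M V = b\<close>, \<open>Q V = 0\<close>; meaningful only where this solution exists and is unique.
\<close>

definition constrained_sol :: "real^'N^'n \<Rightarrow> real^'N^'N \<Rightarrow> real^'N \<Rightarrow> real^'N" where
  "constrained_sol Q M b = (THE V. M *v V = b \<and> Q *v V = 0)"

text \<open>The matrices \<open>S = Q A(\<E>(u))\<close> and \<open>\<L>(u) = D\<^sup>2\<Phi>(\<E>(u)) B(\<E>(u))\<close>, and \<open>\<L>\<^sup>-\<^sup>1(u) b\<close>.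
  \<open>\<L>\<^sup>-\<^sup>1(u)\<close> is not restricted to \<open>b\<close> with \<open>Q b = 0\<close>: the defining system is solvable exactly for
  \<open>b = D\<^sup>2\<Phi>(\<E>(u)) c\<close> with \<open>Q c = 0\<close>, and \<open>S\<^sup>T w\<close> has this form but need not lie in \<open>ker Q\<close>.\<close>

definition S_mat ::
  "real^'N^'n \<Rightarrow> (real^'N \<Rightarrow> real^'N) \<Rightarrow> (real^'n \<Rightarrow> real^'N) \<Rightarrow> real^'n \<Rightarrow> real^'N^'n" where
  "S_mat Q F E u = Q ** jacobian F (at (E u))"

definition L_mat ::
  "(real^'N \<Rightarrow> real) \<Rightarrow> (real^'N \<Rightarrow> real^'N) \<Rightarrow> (real^'n \<Rightarrow> real^'N) \<Rightarrow> real^'n \<Rightarrow> real^'N^'N" where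
  "L_mat \<Phi> R E u = hessian \<Phi> (E u) ** jacobian R (at (E u))"

definition L_inv ::
  "real^'N^'n \<Rightarrow> (real^'N \<Rightarrow> real) \<Rightarrow> (real^'N \<Rightarrow> real^'N) \<Rightarrow> (real^'n \<Rightarrow> real^'N)
    \<Rightarrow> real^'n \<Rightarrow> real^'N \<Rightarrow> real^'N" where
  "L_inv Q \<Phi> R E u b = constrained_sol Q (L_mat \<Phi> R E u) b"

text \<open>
  In what follows \<open>v :: real \<Rightarrow> real^'n\<close> is the spatial profile \<open>u(t, \<cdot>)\<close> of the unknown at a fixed time.
\<close>

text \<open>\<open>\<partial>\<^sub>x F(\<E>(v))\<close> and \<open>\<partial>\<^sub>x D\<^sub>u\<Phi>(\<E>(v))\<close> at \<open>x\<close>.\<close>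

definition dx_flux ::
  "(real^'N \<Rightarrow> real^'N) \<Rightarrow> (real^'n \<Rightarrow> real^'N) \<Rightarrow> (real \<Rightarrow> real^'n) \<Rightarrow> real \<Rightarrow> real^'N" where
  "dx_flux F E v x = vector_derivative (\<lambda>y. F (E (v y))) (at x)"

definition dx_entropy_grad ::
  "(real^'N \<Rightarrow> real) \<Rightarrow> (real^'n \<Rightarrow> real^'N) \<Rightarrow> (real \<Rightarrow> real^'n) \<Rightarrow> real \<Rightarrow> real^'n" where
  "dx_entropy_grad \<Phi> E v x = vector_derivative (\<lambda>y. grad (\<lambda>w. \<Phi> (E w)) (v y)) (at x)"

text \<open>The first-order term of the expansion: \<open>B(\<E>(v)) U\<^sub>1 = - \<partial>\<^sub>x F(\<E>(v))\<close>, \<open>Q U\<^sub>1 = 0\<close>.\<close>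

definition U1 ::
  "real^'N^'n \<Rightarrow> (real^'N \<Rightarrow> real^'N) \<Rightarrow> (real^'N \<Rightarrow> real^'N) \<Rightarrow> (real^'n \<Rightarrow> real^'N)
    \<Rightarrow> (real \<Rightarrow> real^'n) \<Rightarrow> real \<Rightarrow> real^'N" where
  "U1 Q F R E v x = constrained_sol Q (jacobian R (at (E (v x)))) (- dx_flux F E v x)"

text \<open>\<open>S \<L>\<^sup>-\<^sup>1(v) S\<^sup>T (\<partial>\<^sub>x D\<^sub>u\<Phi>(\<E>(v)))\<^sup>T\<close> at \<open>x\<close>.\<close>

definition diffusive_flux ::
  "real^'N^'n \<Rightarrow> (real^'N \<Rightarrow> real^'N) \<Rightarrow> (real^'N \<Rightarrow> real^'N) \<Rightarrow> (real^'n \<Rightarrow> real^'N)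
    \<Rightarrow> (real^'N \<Rightarrow> real) \<Rightarrow> (real \<Rightarrow> real^'n) \<Rightarrow> real \<Rightarrow> real^'n" where
  "diffusive_flux Q F R E \<Phi> v x =
    S_mat Q F E (v x) *v
      L_inv Q \<Phi> R E (v x) (transpose (S_mat Q F E (v x)) *v dx_entropy_grad \<Phi> E v x)"

text \<open>
  Classical solutions \<open>u = u(t, x)\<close>, \<open>t > 0\<close>, with values in \<open>\<omega>\<close>, of \<open>\<partial>\<^sub>t u = - \<partial>\<^sub>x (Q A(\<E>(u)) U\<^sub>1)\<close>
  and of \<open>\<partial>\<^sub>t u = \<partial>\<^sub>x (S \<L>\<^sup>-\<^sup>1(u) S\<^sup>T (\<partial>\<^sub>x D\<^sub>u\<Phi>(\<E>(u)))\<^sup>T)\<close>.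
\<close>

definition limiting_system ::
  "(real^'n) set \<Rightarrow> real^'N^'n \<Rightarrow> (real^'N \<Rightarrow> real^'N) \<Rightarrow> (real^'N \<Rightarrow> real^'N) \<Rightarrow> (real^'n \<Rightarrow> real^'N)
    \<Rightarrow> (real \<Rightarrow> real \<Rightarrow> real^'n) \<Rightarrow> bool" where
  "limiting_system \<omega> Q F R E u \<longleftrightarrow>
    (\<forall>t>0. \<forall>x. u t x \<in> \<omega> \<and> u t differentiable (at x) \<and>
      (\<exists>d. ((\<lambda>s. u s x) has_vector_derivative (- d)) (at t) \<and>
           ((\<lambda>y. (Q ** jacobian F (at (E (u t y)))) *v U1 Q F R E (u t) y)
              has_vector_derivative d) (at x)))"

definition diffusive_system ::
  "(real^'n) set \<Rightarrow> real^'N^'n \<Rightarrow> (real^'N \<Rightarrow> real^'N) \<Rightarrow> (real^'N \<Rightarrow> real^'N) \<Rightarrow> (real^'n \<Rightarrow> real^'N)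
    \<Rightarrow> (real^'N \<Rightarrow> real) \<Rightarrow> (real \<Rightarrow> real \<Rightarrow> real^'n) \<Rightarrow> bool" where
  "diffusive_system \<omega> Q F R E \<Phi> u \<longleftrightarrow>
    (\<forall>t>0. \<forall>x. u t x \<in> \<omega> \<and> u t differentiable (at x) \<and>
      (\<exists>d. ((\<lambda>s. u s x) has_vector_derivative d) (at t) \<and>
           (diffusive_flux Q F R E \<Phi> (u t) has_vector_derivative d) (at x)))"

end

theory Submission
  imports Defs
begin

text \<open>
  Fix an equilibrium \<open>\<E>(u)\<close> and write \<open>A\<close>, \<open>B\<close>, \<open>H\<close> for the Jacobians of \<open>F\<close> and \<open>R\<close> and the
  Hessian of \<open>\<Phi>\<close> there, \<open>D\<close> for the derivative of \<open>\<E>\<close>, and \<open>G\<close> for the derivative of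
  \<open>g(u) = D\<^sub>u\<Phi>(\<E>(u))\<close>.  Everything rests on one identity: by compatibility of the entropy,
  \<open>D\<^sub>U\<Phi>(\<E>(u)) = g(u) Q\<close> on \<open>\<omega>\<close>, and differentiating this gives \<open>H D = Q\<^sup>T G\<close>.  Since \<open>H\<close> and
  \<open>H A\<close> are symmetric,
  \<open>S\<^sup>T G = A\<^sup>T Q\<^sup>T G = A\<^sup>T H D = H A D\<close>.
  Along a profile \<open>v\<close> this reads \<open>S\<^sup>T \<partial>\<^sub>x g(v) = H \<partial>\<^sub>x F(\<E>(v))\<close>; cancelling the invertible \<open>H\<close> in
  \<open>H B V = H \<partial>\<^sub>x F(\<E>(v))\<close> turns the system that defines \<open>\<L>\<^sup>-\<^sup>1\<close> into the one that defines \<open>- U\<^sub>1\<close>,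
  so the two fluxes coincide (\<open>transpose_S_G\<close>, \<open>constrained_sol_L\<close>).

  These systems are uniquely solvable because \<open>B\<close> restricts to a bijection of \<open>ker Q\<close>: conservation
  \<open>Q R = 0\<close> gives \<open>range B \<subseteq> ker Q\<close>, the kernel dimension makes this an equality
  (\<open>range_eq_ker_of_dim\<close>), and \<open>ker B\<close> meets \<open>range B\<close> only in \<open>0\<close> (\<open>ex1_ker_solution\<close>).  The right-hand
  side \<open>S\<^sup>T w\<close> is admissible for every \<open>w\<close> because \<open>G = D\<^sup>T H D\<close> is positive definite, hence onto, and
  because \<open>Q A D = 0\<close> by differentiating \<open>Q F(\<E>(u)) = 0\<close>.

  Dissipation reduces to \<open>V\<^sup>T H B V \<ge> 0\<close>.  As \<open>D\<^sub>U\<Phi>(\<E>(u)) R(U) = g(u) Q R(U) = 0\<close>, the entropy inequality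
  says \<open>(D\<^sub>U\<Phi>(U) - D\<^sub>U\<Phi>(\<E>(u))) R(U) \<ge> 0\<close>, a product of two factors that vanish at \<open>\<E>(u)\<close>; its leading
  term in the direction \<open>V\<close> is \<open>(H V) \<bullet> (B V)\<close> (\<open>derivatives_inner_nonneg_at_zero\<close>).

  Two ingredients are regularity facts.  The symmetry of \<open>H\<close> is the theorem of Schwarz
  (\<open>second_derivative_symmetric\<close>).  The derivative \<open>D\<close> exists by the inverse function
  theorem, since uniqueness of equilibria identifies \<open>\<E>\<close> with a smooth local inverse (\<open>zero_set_section_differentiable\<close>).
\<close>

section \<open>Gradients and symmetry of second derivatives\<close>

lemma GDERIV_grad_eq:
  fixes f :: "real^'k \<Rightarrow> real"
  assumes "GDERIV f x :> D"
  shows "grad f x = D"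
proof -
  have "D' = D" if "GDERIV f x :> D'" for D'
  proof -
    have "(\<lambda>h. h \<bullet> D') = (\<lambda>h. h \<bullet> D)"
      using that assms unfolding gderiv_def by (rule has_derivative_unique)
    then have "h \<bullet> D' = h \<bullet> D" for h
      by meson
    then show ?thesis
      using vector_eq_ldot[of D' D] by blast
  qed
  with assms show ?thesis
    unfolding grad_def by blast
qed

lemma differentiable_GDERIV_grad:
  fixes f :: "real^'k \<Rightarrow> real"
  assumes "f differentiable (at x)"
  shows "GDERIV f x :> grad f x"
proof -
  from assms obtain f' where f': "(f has_derivative f') (at x)"
    unfolding differentiable_def by blast
  then have "linear f'"
    using has_derivative_linear by blast
  then have "f' = (\<lambda>h. h \<bullet> adjoint f' 1)"
    using adjoint_works[of f' _ 1] by (auto simp: fun_eq_iff)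
  with f' have "GDERIV f x :> adjoint f' 1"
    unfolding gderiv_def by metis
  moreover have "grad f x = adjoint f' 1"
    using calculation by (rule GDERIV_grad_eq)
  ultimately show ?thesis
    by simp
qed

lemma C1_on_has_derivative:
  fixes f :: "real^'k \<Rightarrow> real^'m"
  assumes "C1_on X f" "x \<in> X"
  shows "(f has_derivative (\<lambda>h. jacobian f (at x) *v h)) (at x)"
  using assms unfolding C1_on_def jacobian_works[symmetric] by blast

text \<open>
  The mean value theorem in the direction \<open>k\<close> turns the mixed second difference into a difference of
  gradients, to which differentiability of the gradient at the single point \<open>x\<close> applies.  The second
  difference is symmetric in \<open>h\<close> and \<open>k\<close>, so comparing with the estimate for \<open>k\<close> and \<open>h\<close> yields the
  symmetry of the second derivative.
\<close>
lemma second_difference_estimate: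
  fixes f :: "'a::real_inner \<Rightarrow> real" and g H :: "'a \<Rightarrow> 'a"
  assumes "open X" "x \<in> X" and f: "\<And>y. y \<in> X \<Longrightarrow> GDERIV f y :> g y"
    and g: "(g has_derivative H) (at x)" and "e > 0"
  shows "\<forall>\<^sub>F t in at_right 0.
    \<bar>f (x + t *\<^sub>R h + t *\<^sub>R k) - f (x + t *\<^sub>R h) - f (x + t *\<^sub>R k) + f x - t\<^sup>2 * (H h \<bullet> k)\<bar> \<le> e * t\<^sup>2"
proof -
  \<comment> \<open>The two gradient errors below are at most \<open>c t M\<close> each and are multiplied by \<open>t |k| \<le> t M\<close>;
    this choice of \<open>c\<close> makes the total \<open>e t\<^sup>2\<close>.\<close>
  define M where "M = norm h + norm k + 1"
  define c where "c = e / (2 * M * M)"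
  have M: "M > 0" "norm h + norm k \<le> M" "norm k \<le> M" and c: "c > 0"
    using \<open>e > 0\<close> by (auto simp: M_def c_def add_nonneg_pos)
  have linH: "linear H"
    using g has_derivative_linear by blast
  obtain r where r: "r > 0" "ball x r \<subseteq> X"
    using \<open>open X\<close> \<open>x \<in> X\<close> open_contains_ball by blast
  obtain d where d: "d > 0" "\<And>y. norm (y - x) < d \<Longrightarrow> norm (g y - g x - H (y - x)) \<le> c * norm (y - x)"
    using g c unfolding has_derivative_at_alt by blast
  have main: "\<bar>f (x + t *\<^sub>R h + t *\<^sub>R k) - f (x + t *\<^sub>R h) - f (x + t *\<^sub>R k) + f x - t\<^sup>2 * (H h \<bullet> k)\<bar> \<le> e * t\<^sup>2"
    if t: "t > 0" "t * M < d" "t * M < r" for t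
  proof -
    have small: "norm (a *\<^sub>R h + s *\<^sub>R k) \<le> t * M" if "0 \<le> a" "a \<le> t" "0 \<le> s" "s \<le> t" for a s
    proof -
      have "norm (a *\<^sub>R h + s *\<^sub>R k) \<le> a * norm h + s * norm k"
        using that norm_triangle_ineq[of "a *\<^sub>R h" "s *\<^sub>R k"] by simp
      also have "\<dots> \<le> t * norm h + t * norm k"
        using that by (intro add_mono mult_right_mono) auto
      also have "\<dots> \<le> t * M"
        using M t by (simp flip: distrib_left)
      finally show ?thesis .
    qed
    have in_X: "x + (a *\<^sub>R h + s *\<^sub>R k) \<in> X" if "0 \<le> a" "a \<le> t" "0 \<le> s" "s \<le> t" for a s
    proof -
      have "dist (x + (a *\<^sub>R h + s *\<^sub>R k)) x < r"
        using small[OF that] t(3) unfolding dist_norm by simp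
      then show ?thesis
        using r(2) by (auto simp: dist_commute)
    qed
    have err: "norm (g (x + y) - g x - H y) \<le> c * (t * M)"
      if "norm y \<le> t * M" for y
    proof -
      have "norm (g (x + y) - g x - H y) \<le> c * norm y"
        using d(2)[of "x + y"] that t(2) by simp
      also have "\<dots> \<le> c * (t * M)"
        using that c by (intro mult_left_mono) auto
      finally show ?thesis .
    qed
    define \<psi> where "\<psi> s = f (x + (t *\<^sub>R h + s *\<^sub>R k)) - f (x + (0 *\<^sub>R h + s *\<^sub>R k))" for s
    have der: "((\<lambda>s. f (x + (a *\<^sub>R h + s *\<^sub>R k))) has_derivative
        (\<lambda>z. z * (k \<bullet> g (x + (a *\<^sub>R h + s *\<^sub>R k))))) (at s)"
      if "0 \<le> a" "a \<le> t" "0 \<le> s" "s \<le> t" for a s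
    proof -
      have f': "(f has_derivative (\<lambda>y. y \<bullet> g (x + (a *\<^sub>R h + s *\<^sub>R k)))) (at (x + (a *\<^sub>R h + s *\<^sub>R k)))"
        using f[OF in_X[OF that]] by (simp add: gderiv_def)
      have "((\<lambda>s. x + (a *\<^sub>R h + s *\<^sub>R k)) has_derivative (\<lambda>z. z *\<^sub>R k)) (at s)"
        by (auto intro!: derivative_eq_intros)
      from has_derivative_compose[OF this f'] show ?thesis
        by simp
    qed
    have "(\<psi> has_derivative (\<lambda>z. z * (k \<bullet> g (x + (t *\<^sub>R h + s *\<^sub>R k)))
        - z * (k \<bullet> g (x + (0 *\<^sub>R h + s *\<^sub>R k))))) (at s)" if "0 \<le> s" "s \<le> t" for s
      unfolding \<psi>_def using that t by (intro has_derivative_diff der) auto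
    then obtain s where s: "0 < s" "s < t" and "\<psi> t - \<psi> 0 = (t - 0) * (k \<bullet> g (x + (t *\<^sub>R h + s *\<^sub>R k)))
        - (t - 0) * (k \<bullet> g (x + (0 *\<^sub>R h + s *\<^sub>R k)))"
      using mvt_simple[of 0 t \<psi>] t(1) has_derivative_at_withinI by (metis (no_types, lifting) greaterThanLessThan_iff less_imp_le)
    then have psi: "\<psi> t - \<psi> 0 = t * (k \<bullet> (g (x + (t *\<^sub>R h + s *\<^sub>R k)) - g (x + s *\<^sub>R k)))"
      by (simp add: algebra_simps inner_diff_right)
    define a b where "a = g (x + (t *\<^sub>R h + s *\<^sub>R k)) - g x - H (t *\<^sub>R h + s *\<^sub>R k)"
      and "b = g (x + s *\<^sub>R k) - g x - H (s *\<^sub>R k)"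
    have ab: "norm a \<le> c * (t * M)" "norm b \<le> c * (t * M)"
      using small[of t s] small[of 0 s] s t(1) unfolding a_def b_def by (auto intro!: err)
    have "H (t *\<^sub>R h + s *\<^sub>R k) - H (s *\<^sub>R k) = t *\<^sub>R H h"
      using linH by (simp add: linear_add linear_scale)
    then have "g (x + (t *\<^sub>R h + s *\<^sub>R k)) - g (x + s *\<^sub>R k) = t *\<^sub>R H h + (a - b)"
      unfolding a_def b_def by (simp add: algebra_simps)
    then have "\<psi> t - \<psi> 0 = t * (k \<bullet> (t *\<^sub>R H h + (a - b)))"
      by (simp only: psi)
    then have "\<psi> t - \<psi> 0 - t\<^sup>2 * (H h \<bullet> k) = t * (k \<bullet> (a - b))"
      by (simp add: inner_add_right inner_commute[of _ k] power2_eq_square distrib_left)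
    also have "\<bar>\<dots>\<bar> \<le> t * (norm k * norm (a - b))"
      using t(1) by (simp add: abs_mult Cauchy_Schwarz_ineq2)
    also have "\<dots> \<le> t * (M * (c * (t * M) + c * (t * M)))"
    proof (intro mult_left_mono mult_mono)
      show "norm (a - b) \<le> c * (t * M) + c * (t * M)"
        using ab norm_triangle_ineq4[of a b] by linarith
    qed (use t(1) M in auto)
    also have "\<dots> = e * t\<^sup>2"
      using M by (simp add: c_def power2_eq_square field_simps)
    finally show ?thesis
      by (simp add: \<psi>_def algebra_simps)
  qed
  have "\<forall>\<^sub>F t in at_right 0. t < min d r / M"
    using d(1) r(1) M(1) eventually_at_right_real[of 0 "min d r / M"]
    by (auto elim: eventually_mono)
  moreover have "\<forall>\<^sub>F t in at_right 0. (t::real) > 0"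
    by (simp add: eventually_at_right_less)
  ultimately show ?thesis
  proof eventually_elim
    case (elim t)
    then show ?case
      using M(1) by (intro main) (auto simp: field_simps)
  qed
qed

lemma second_derivative_symmetric:
  fixes f :: "'a::real_inner \<Rightarrow> real" and g H :: "'a \<Rightarrow> 'a"
  assumes "open X" "x \<in> X" and "\<And>y. y \<in> X \<Longrightarrow> GDERIV f y :> g y"
    and "(g has_derivative H) (at x)"
  shows "H h \<bullet> k = h \<bullet> H k"
proof -
  have "\<bar>H h \<bullet> k - H k \<bullet> h\<bar> \<le> 0 + e" if "e > 0" for e :: real
  proof -
    have est: "\<forall>\<^sub>F t in at_right 0. \<bar>f (x + t *\<^sub>R h + t *\<^sub>R k) - f (x + t *\<^sub>R h) - f (x + t *\<^sub>R k) + f x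
        - t\<^sup>2 * (H h \<bullet> k)\<bar> \<le> e / 2 * t\<^sup>2" for h k
      by (rule second_difference_estimate[OF assms(1,2) _ assms(4)]) (use assms(3) that in auto)
    have "\<forall>\<^sub>F t in at_right 0. (t::real) > 0"
      by (simp add: eventually_at_right_less)
    with est[of h k] est[of k h] have "\<forall>\<^sub>F t in at_right (0::real). \<bar>H h \<bullet> k - H k \<bullet> h\<bar> \<le> e"
    proof eventually_elim
      case (elim t)
      have "x + t *\<^sub>R k + t *\<^sub>R h = x + t *\<^sub>R h + t *\<^sub>R k"
        by simp
      with elim have "\<bar>t\<^sup>2 * (H h \<bullet> k) - t\<^sup>2 * (H k \<bullet> h)\<bar> \<le> e / 2 * t\<^sup>2 + e / 2 * t\<^sup>2"
        by (simp only:)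
      then have "\<bar>t\<^sup>2 * (H h \<bullet> k) - t\<^sup>2 * (H k \<bullet> h)\<bar> \<le> e * t\<^sup>2"
        by simp
      then have "t\<^sup>2 * \<bar>H h \<bullet> k - H k \<bullet> h\<bar> \<le> t\<^sup>2 * e"
        by (simp add: abs_mult mult.commute[of e] flip: right_diff_distrib)
      with elim show ?case
        by simp
    qed
    then show ?thesis
      by (simp add: eventually_const)
  qed
  then have "\<bar>H h \<bullet> k - H k \<bullet> h\<bar> \<le> 0"
    by (rule field_le_epsilon)
  then show ?thesis
    by (simp add: inner_commute)
qed

section \<open>Solvability on the kernel of \<open>Q\<close>\<close>

lemma subspace_ker:
  fixes Q :: "real^'N^'n"
  shows "subspace {c. Q *v c = 0}"
  by (simp add: subspace_def matrix_vector_right_distrib matrix_vector_mult_scaleR)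

text \<open>Both sides have dimension \<open>N - n\<close> by rank-nullity, and the inclusion of the range in the kernel
  is the second premise.\<close>
lemma range_eq_ker_of_dim:
  fixes B :: "real^'N^'N" and Q :: "real^'N^'n"
  assumes "surj ((*v) Q)" "\<And>V. Q *v (B *v V) = 0" "dim {V. B *v V = 0} = CARD('n)"
  shows "range ((*v) B) = {c. Q *v c = 0}"
proof -
  have nullity: "dim {V. M *v V = 0} + dim (range ((*v) M)) = CARD('N)" for M :: "real^'N^'m"
  proof -
    have "{V. M *v V = 0} = {y \<in> UNIV. \<forall>x\<in>span (rows M). orthogonal x y}" (is "?N = ?O")
    proof (intro set_eqI iffI)
      fix y assume "y \<in> ?N"
      then show "y \<in> ?O"
        using orthogonal_nullspace_rowspace[of M y] by (auto simp: orthogonal_commute)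
    next
      fix y assume y: "y \<in> ?O"
      have "row i M \<bullet> y = 0" for i
        using y span_base[of "row i M" "rows M"] by (auto simp: orthogonal_def rows_def)
      then show "y \<in> ?N"
        by (simp add: vec_eq_iff matrix_vector_mul_component row_def)
    qed
    moreover have "dim (range ((*v) M)) = dim (span (rows M))"
      by (simp add: row_rank_def flip: rank_dim_range)
    ultimately show ?thesis
      using dim_subspace_orthogonal_to_vectors[of "span (rows M)" UNIV] by simp
  qed
  have "dim {c. Q *v c = 0} + CARD('n) = CARD('N)"
    using nullity[of Q] assms(1) by simp
  moreover have "dim (range ((*v) B)) + CARD('n) = CARD('N)"
    using nullity[of B] assms(3) by simp
  ultimately show ?thesis
    using assms(2)
    by (intro subspace_dim_equal subspace_ker linear_subspace_image[of "(*v) B" UNIV]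
        matrix_vector_mul_linear) auto
qed

text \<open>\<open>B\<close> maps \<open>ker Q = range B\<close> into itself, injectively since \<open>ker B\<close> meets it only in \<open>0\<close>, and
  hence bijectively by dimension.\<close>
lemma ex1_ker_solution:
  fixes B :: "real^'N^'N" and Q :: "real^'N^'n"
  assumes range_B: "range ((*v) B) = {c. Q *v c = 0}"
    and trivial: "{V. B *v V = 0} \<inter> range ((*v) B) = {0}"
    and "Q *v c = 0"
  shows "\<exists>!V. B *v V = c \<and> Q *v V = 0"
proof -
  let ?K = "{c. Q *v c = 0}"
  have K: "subspace ?K"
    by (rule subspace_ker)
  have inj: "V = 0" if "B *v V = 0" "Q *v V = 0" for V
    using that trivial unfolding range_B by blast
  have "inj_on ((*v) B) ?K"
    using K by (subst linear_inj_on_iff_eq_0[OF matrix_vector_mul_linear]) (use inj in auto)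
  moreover have "(*v) B ` ?K \<subseteq> ?K"
    using range_B by blast
  ultimately have "(*v) B ` ?K = ?K"
    using K by (intro subspace_dim_equal linear_subspace_image[OF matrix_vector_mul_linear])
      (auto simp: dim_image_eq[OF matrix_vector_mul_linear] span_eq_iff[THEN iffD2])
  with \<open>Q *v c = 0\<close> have "c \<in> (*v) B ` ?K"
    by simp
  then obtain V where "B *v V = c" "Q *v V = 0"
    by auto
  moreover have "V' = V" if "B *v V' = c" "Q *v V' = 0" for V'
    using inj[of "V' - V"] that calculation by (simp add: matrix_vector_mult_diff_distrib)
  ultimately show ?thesis
    by blast
qed

section \<open>Differentiability of the equilibrium map\<close>

lemma has_derivative_matrix_comp:
  fixes M :: "real^'k^'m"
  assumes "(f has_derivative f') (at x)"
  shows "((\<lambda>y. M *v f y) has_derivative (\<lambda>h. M *v f' h)) (at x)"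
  by (rule has_derivative_compose[OF assms
      bounded_linear_imp_has_derivative[OF matrix_vector_mul_bounded_linear]])

lemma has_derivative_unique_on_open:
  assumes "(f has_derivative f') (at x)" "(g has_derivative g') (at x)"
    and "open X" "x \<in> X" "\<And>y. y \<in> X \<Longrightarrow> f y = g y"
  shows "f' h = g' h"
proof -
  have "(g has_derivative f') (at x)"
    using assms(1,3-5) by (rule has_derivative_transform_within_open)
  then have "f' = g'"
    using assms(2) by (rule has_derivative_unique)
  then show ?thesis
    by simp
qed

lemma has_vector_derivative_along_curve:
  fixes M :: "real^'k^'m"
  assumes "(v has_vector_derivative v') (at x)" "(f has_derivative (\<lambda>z. M *v z)) (at (v x))"
  shows "((\<lambda>y. f (v y)) has_vector_derivative (M *v v')) (at x)"
  using has_derivative_compose[OF assms(1)[unfolded has_vector_derivative_def] assms(2)]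
  by (simp add: has_vector_derivative_def matrix_vector_mult_scaleR)

text \<open>
  The map \<open>G(U) = R(U) + P Q U\<close> is a local diffeomorphism at \<open>U0\<close>: applying \<open>Q\<close> to
  \<open>(B + P Q) V = 0\<close> leaves \<open>Q V = 0\<close>, hence \<open>B V = 0\<close> and \<open>V = 0\<close>.  Applying \<open>Q\<close> to \<open>G(U) = P w\<close>
  shows in the same way that \<open>U\<close> is a zero of \<open>R\<close> with \<open>Q U = w\<close>.  By uniqueness, \<open>E(w)\<close> is then the
  local inverse of \<open>G\<close> at \<open>P w\<close>.
\<close>
lemma zero_set_section_differentiable:
  fixes R :: "real^'N \<Rightarrow> real^'N" and Q :: "real^'N^'n" and P :: "real^'n^'N"
    and E :: "real^'n \<Rightarrow> real^'N"
  assumes "open X" and R: "C1_on X R" and QP: "Q ** P = mat 1"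
    and QR: "\<And>U. U \<in> X \<Longrightarrow> Q *v R U = 0"
    and U0: "U0 \<in> X" "R U0 = 0"
    and unique: "\<And>U. U \<in> X \<Longrightarrow> R U = 0 \<Longrightarrow> U = E (Q *v U)"
    and inj: "\<And>V. jacobian R (at U0) *v V = 0 \<Longrightarrow> Q *v V = 0 \<Longrightarrow> V = 0"
    and QB: "\<And>V. Q *v (jacobian R (at U0) *v V) = 0"
  shows "E differentiable (at (Q *v U0))"
proof -
  have QPv: "Q *v (P *v y) = y" for y
    by (simp add: matrix_vector_mul_assoc QP)
  define G where "G U = R U + P *v (Q *v U)" for U
  define G' where "G' U = Blinfun (\<lambda>V. jacobian R (at U) *v V + P *v (Q *v V))" for U
  have bl: "bounded_linear (\<lambda>V. jacobian R (at U) *v V + P *v (Q *v V))" for U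
    using bounded_linear_add bounded_linear_compose[OF matrix_vector_mul_bounded_linear matrix_vector_mul_bounded_linear]
    by (intro bounded_linear_add matrix_vector_mul_bounded_linear
        bounded_linear_compose[OF matrix_vector_mul_bounded_linear matrix_vector_mul_bounded_linear])
  have G'_apply: "blinfun_apply (G' U) V = jacobian R (at U) *v V + P *v (Q *v V)" for U V
    unfolding G'_def using bl by (subst bounded_linear_Blinfun_apply) auto
  have derG: "(G has_derivative blinfun_apply (G' U)) (at U)" if "U \<in> X" for U
    unfolding G_def G'_apply
    by (intro has_derivative_add C1_on_has_derivative[OF R that]
        bounded_linear_imp_has_derivative
        bounded_linear_compose[OF matrix_vector_mul_bounded_linear matrix_vector_mul_bounded_linear])
  have contG': "continuous_on X G'"
  proof (rule continuous_on_blinfun_componentwise)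
    fix i :: "real^'N"
    have "continuous_on X (\<lambda>U. jacobian R (at U) *v i)"
    proof (rule bounded_linear.continuous_on[of "\<lambda>M. M *v i"])
      show "bounded_linear (\<lambda>M :: real^'N^'N. M *v i)"
        unfolding linear_conv_bounded_linear[symmetric]
        by (intro linearI) (simp_all add: matrix_vector_mult_add_rdistrib scaleR_matrix_vector_assoc)
      show "continuous_on X (\<lambda>U. jacobian R (at U))"
        using R unfolding C1_on_def by blast
    qed
    then show "continuous_on X (\<lambda>U. blinfun_apply (G' U) i)"
      unfolding G'_apply by (intro continuous_intros)
  qed
  have "linear (blinfun_apply (G' U0))"
    by (simp add: bounded_linear.linear blinfun.bounded_linear_right)
  moreover have "inj (blinfun_apply (G' U0))"
  proof (subst linear_injective_0[OF calculation], intro allI impI)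
    fix V assume "blinfun_apply (G' U0) V = 0"
    then have *: "jacobian R (at U0) *v V + P *v (Q *v V) = 0"
      by (simp add: G'_apply)
    then have "Q *v (jacobian R (at U0) *v V + P *v (Q *v V)) = 0"
      by simp
    then have "Q *v V = 0"
      by (simp add: matrix_vector_right_distrib QB QPv)
    with * inj show "V = 0"
      by simp
  qed
  ultimately obtain J where J: "linear J" "J \<circ> blinfun_apply (G' U0) = id"
    using linear_injective_left_inverse by blast
  then have "bounded_linear J"
    by (simp add: linear_conv_bounded_linear)
  have "Blinfun J o\<^sub>L G' U0 = id_blinfun"
    using J(2) by (intro blinfun_eqI) (simp add: bounded_linear_Blinfun_apply[OF \<open>bounded_linear J\<close>] fun_eq_iff)
  then obtain X' Y g g' where Y: "X' \<subseteq> X" "open Y" "G U0 \<in> Y" "homeomorphism X' Y G g"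
    "\<And>y. y \<in> Y \<Longrightarrow> (g has_derivative (g' y)) (at y)"
    using inverse_function_theorem[OF \<open>open X\<close> derG contG' U0(1)] by metis
  have GU0: "G U0 = P *v (Q *v U0)"
    using U0 by (simp add: G_def)
  have E_eq: "E w = g (P *v w)" if "P *v w \<in> Y" for w
  proof -
    let ?U = "g (P *v w)"
    have U: "?U \<in> X" "G ?U = P *v w"
      using that Y unfolding homeomorphism_def by auto
    then have "Q *v (R ?U + P *v (Q *v ?U)) = Q *v (P *v w)"
      by (simp add: G_def)
    then have "Q *v ?U = w"
      using QR[OF U(1)] by (simp add: matrix_vector_right_distrib QPv)
    moreover have "R ?U = 0"
      using U(2) calculation by (simp add: G_def)
    ultimately show ?thesis
      using unique[OF U(1)] by simp
  qed
  have "((\<lambda>w. P *v w) has_derivative (\<lambda>w. P *v w)) (at (Q *v U0))"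
    by (simp add: bounded_linear_imp_has_derivative)
  from has_derivative_compose[OF this] have
    "((\<lambda>w. g (P *v w)) has_derivative (\<lambda>z. g' (G U0) (P *v z))) (at (Q *v U0))"
    using Y(5)[OF Y(3)] unfolding GU0 by blast
  moreover have "open ((\<lambda>w. P *v w) -` Y)"
    using \<open>open Y\<close> by (intro open_vimage) (auto intro!: linear_continuous_on)
  moreover have "Q *v U0 \<in> (\<lambda>w. P *v w) -` Y"
    using Y(3) GU0 by simp
  ultimately have "(E has_derivative (\<lambda>z. g' (G U0) (P *v z))) (at (Q *v U0))"
    by (rule has_derivative_transform_within_open) (simp add: E_eq)
  then show ?thesis
    unfolding differentiable_def by blast
qed

section \<open>Positivity at an equilibrium\<close>

text \<open>Both factors are first order near \<open>x\<close>, so the sign of their product passes to the product of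
  the difference quotients along \<open>x + s V\<close>, whose limit at \<open>s = 0\<close> is the claim.\<close>
lemma derivatives_inner_nonneg_at_zero:
  fixes p r p' r' :: "'a::real_inner \<Rightarrow> 'a"
  assumes "open X" "x \<in> X" and p: "(p has_derivative p') (at x)" and r: "(r has_derivative r') (at x)"
    and "r x = 0" and nonneg: "\<And>y. y \<in> X \<Longrightarrow> (p y - p x) \<bullet> r y \<ge> 0"
  shows "p' V \<bullet> r' V \<ge> 0"
proof -
  have line: "((\<lambda>s. x + s *\<^sub>R V) has_derivative (\<lambda>s. s *\<^sub>R V)) (at 0)"
    by (auto intro!: derivative_eq_intros)
  have quot: "((\<lambda>s. (q (x + s *\<^sub>R V) - q x) /\<^sub>R s) \<longlongrightarrow> q' V) (at 0)"
    if "(q has_derivative q') (at x)" for q q' :: "'a \<Rightarrow> 'a"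
  proof -
    have "((\<lambda>s. q (x + s *\<^sub>R V)) has_derivative (\<lambda>s. s *\<^sub>R q' V)) (at 0)"
      using has_derivative_compose[OF line, of q q'] that
        linear_scale[OF has_derivative_linear[OF that]] by simp
    then have "((\<lambda>s. norm (q (x + s *\<^sub>R V) - q x - s *\<^sub>R q' V) / \<bar>s\<bar>) \<longlongrightarrow> 0) (at 0)"
      by (simp add: has_derivative_at)
    moreover have "\<forall>\<^sub>F s in at 0. norm (q (x + s *\<^sub>R V) - q x - s *\<^sub>R q' V) / \<bar>s\<bar>
        = norm ((q (x + s *\<^sub>R V) - q x) /\<^sub>R s - q' V)"
      unfolding eventually_at_filter
    proof (intro always_eventually allI impI)
      fix s :: real assume "s \<noteq> 0"
      then have "(q (x + s *\<^sub>R V) - q x) /\<^sub>R s - q' V = (q (x + s *\<^sub>R V) - q x - s *\<^sub>R q' V) /\<^sub>R s"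
        by (simp add: scaleR_diff_right)
      then show "norm (q (x + s *\<^sub>R V) - q x - s *\<^sub>R q' V) / \<bar>s\<bar>
          = norm ((q (x + s *\<^sub>R V) - q x) /\<^sub>R s - q' V)"
        by (simp add: divide_inverse mult.commute)
    qed
    ultimately have "((\<lambda>s. norm ((q (x + s *\<^sub>R V) - q x) /\<^sub>R s - q' V)) \<longlongrightarrow> 0) (at 0)"
      by (simp cong: tendsto_cong add: tendsto_cong)
    then show ?thesis
      using Lim_null tendsto_norm_zero_iff by blast
  qed
  have lim: "((\<lambda>s. ((p (x + s *\<^sub>R V) - p x) /\<^sub>R s) \<bullet> ((r (x + s *\<^sub>R V) - r x) /\<^sub>R s)) \<longlongrightarrow> p' V \<bullet> r' V) (at 0)"
    by (intro tendsto_inner quot p r)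
  have "((\<lambda>s. x + s *\<^sub>R V) \<longlongrightarrow> x + 0 *\<^sub>R V) (at 0)"
    by (intro tendsto_intros)
  then have "\<forall>\<^sub>F s in at 0. x + s *\<^sub>R V \<in> X"
    using \<open>open X\<close> \<open>x \<in> X\<close> by (simp add: topological_tendstoD)
  then have "\<forall>\<^sub>F s in at 0. 0 \<le> ((p (x + s *\<^sub>R V) - p x) /\<^sub>R s) \<bullet> ((r (x + s *\<^sub>R V) - r x) /\<^sub>R s)"
  proof eventually_elim
    case (elim s)
    have "((p (x + s *\<^sub>R V) - p x) /\<^sub>R s) \<bullet> ((r (x + s *\<^sub>R V) - r x) /\<^sub>R s)
        = (inverse s)\<^sup>2 * ((p (x + s *\<^sub>R V) - p x) \<bullet> r (x + s *\<^sub>R V))"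
      using \<open>r x = 0\<close> by (simp add: power2_eq_square)
    then show ?case
      using nonneg[OF elim] by simp
  qed
  with lim show ?thesis
    by (rule tendsto_lowerbound) simp
qed

section \<open>Linear algebra at a fixed equilibrium\<close>

text \<open>
  \<open>A\<close>, \<open>B\<close>, \<open>H\<close> are the Jacobians of \<open>F\<close> and \<open>R\<close> and the Hessian of the entropy, \<open>D\<close> and \<open>G\<close> the
  derivatives of the equilibrium map and of \<open>u \<mapsto> D\<^sub>u\<Phi>(\<E>(u))\<close>.  In this notation \<open>S = Q A\<close> and
  \<open>\<L> = H B\<close>.
\<close>
locale linearized_relaxation =
  fixes Q :: "real^'N^'n" and A B H :: "real^'N^'N" and D :: "real^'n^'N" and G :: "real^'n^'n"
  assumes H_sym: "transpose H = H" and H_pos: "V \<noteq> 0 \<Longrightarrow> V \<bullet> (H *v V) > 0"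
    and HA_sym: "transpose (H ** A) = H ** A"
    and QB: "Q *v (B *v V) = 0"
    and B_ker_Q: "Q *v c = 0 \<Longrightarrow> \<exists>!V. B *v V = c \<and> Q *v V = 0"
    and HB_nonneg: "(H *v V) \<bullet> (B *v V) \<ge> 0"
    and QD: "Q *v (D *v z) = z"
    and HD: "H *v (D *v z) = transpose Q *v (G *v z)"
    and QAD: "Q *v (A *v (D *v z)) = 0"
begin

lemma H_inj: "H *v V = H *v W \<longleftrightarrow> V = W"
  using H_pos[of "V - W"] by (cases "V = W") (auto simp: matrix_vector_mult_diff_distrib)

lemma L_eq_iff: "(H ** B) *v V = H *v c \<longleftrightarrow> B *v V = c"
  by (simp add: H_inj flip: matrix_vector_mul_assoc)

text \<open>\<open>G = D\<^sup>T Q\<^sup>T G = D\<^sup>T H D\<close> is positive definite, since \<open>D\<close> has the left inverse \<open>Q\<close>.\<close>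
lemma G_surj: "\<exists>z. G *v z = w"
proof -
  have "z = 0" if "G *v z = 0" for z
  proof -
    have "H *v (D *v z) = 0"
      using that by (simp add: HD)
    then have "D *v z = 0"
      using H_inj[of "D *v z" 0] by simp
    then show ?thesis
      using QD[of z] by simp
  qed
  then have "inj ((*v) G)"
    by (subst linear_injective_0[OF matrix_vector_mul_linear]) blast
  then have "surj ((*v) G)"
    by (intro linear_injective_imp_surjective matrix_vector_mul_linear) auto
  then show ?thesis
    by (metis surjD)
qed

text \<open>The identity behind the diffusive form: both symmetries, of \<open>H\<close> and of \<open>H A\<close>, enter here.\<close>
lemma transpose_S_G: "transpose (Q ** A) *v (G *v z) = H *v (A *v (D *v z))"
proof -
  have "transpose (Q ** A) *v (G *v z) = transpose A *v (transpose Q *v (G *v z))"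
    by (simp only: matrix_transpose_mul flip: matrix_vector_mul_assoc)
  also have "\<dots> = transpose (H ** A) *v (D *v z)"
    by (simp only: matrix_transpose_mul H_sym flip: HD matrix_vector_mul_assoc)
  finally show ?thesis
    by (simp add: HA_sym flip: matrix_vector_mul_assoc)
qed

lemma L_solvable_iff:
  "(\<exists>V. (H ** B) *v V = b \<and> Q *v V = 0) \<longleftrightarrow> b \<in> (\<lambda>c. H *v c) ` {c. Q *v c = 0}"
proof
  assume "\<exists>V. (H ** B) *v V = b \<and> Q *v V = 0"
  then obtain V where "b = H *v (B *v V)"
    by (auto simp flip: matrix_vector_mul_assoc)
  then show "b \<in> (\<lambda>c. H *v c) ` {c. Q *v c = 0}"
    using QB by blast
next
  assume "b \<in> (\<lambda>c. H *v c) ` {c. Q *v c = 0}"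
  then show "\<exists>V. (H ** B) *v V = b \<and> Q *v V = 0"
    using B_ker_Q L_eq_iff by blast
qed

lemma L_solution_unique: "\<exists>\<^sub>\<le>\<^sub>1V. (H ** B) *v V = b \<and> Q *v V = 0"
proof (rule Uniq_I, elim conjE)
  fix V W assume VW: "(H ** B) *v V = b" "(H ** B) *v W = b" "Q *v V = 0" "Q *v W = 0"
  have "B *v V = B *v W"
    using VW(1,2) by (metis H_inj matrix_vector_mul_assoc)
  with VW(3,4) B_ker_Q[OF QB[of W]] show "V = W"
    by blast
qed

lemma L_ex1_iff:
  "(\<exists>!V. (H ** B) *v V = b \<and> Q *v V = 0) \<longleftrightarrow> b \<in> (\<lambda>c. H *v c) ` {c. Q *v c = 0}"
  using L_solvable_iff[of b] L_solution_unique[of b] by (auto simp: ex1_iff_ex_Uniq)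

text \<open>Write \<open>w = G z\<close>; then \<open>S\<^sup>T w = H (A D z)\<close> with \<open>A D z\<close> in the kernel of \<open>Q\<close>.\<close>
lemma L_ex1_transpose_S: "\<exists>!V. (H ** B) *v V = transpose (Q ** A) *v w \<and> Q *v V = 0"
  using G_surj[of w] transpose_S_G QAD unfolding L_ex1_iff by (metis (mono_tags) image_eqI mem_Collect_eq)

text \<open>With \<open>z = \<partial>\<^sub>x v\<close> the right-hand side is \<open>- U\<^sub>1\<close>, as \<open>\<partial>\<^sub>x F(\<E>(v)) = A D \<partial>\<^sub>x v\<close>.\<close>
lemma constrained_sol_L:
  "constrained_sol Q (H ** B) (transpose (Q ** A) *v (G *v z))
     = - constrained_sol Q B (- (A *v (D *v z)))"
proof -
  have neg: "Q *v (- (A *v (D *v z))) = 0"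
    by (simp add: QAD linear_neg[OF matrix_vector_mul_linear])
  define V where "V = constrained_sol Q B (- (A *v (D *v z)))"
  have V: "B *v V = - (A *v (D *v z)) \<and> Q *v V = 0"
    unfolding V_def constrained_sol_def using B_ker_Q[OF neg] by (rule theI')
  have "(H ** B) *v (- V) = transpose (Q ** A) *v (G *v z) \<and> Q *v (- V) = 0"
    using V by (simp add: transpose_S_G del: transpose_matrix_vector add: linear_neg[OF matrix_vector_mul_linear] flip: matrix_vector_mul_assoc)
  with L_ex1_transpose_S show ?thesis
    unfolding V_def[symmetric] by (subst constrained_sol_def) (rule the1_equality)
qed

lemma dissipation_nonneg:
  "w \<bullet> ((Q ** A) *v constrained_sol Q (H ** B) (transpose (Q ** A) *v w)) \<ge> 0"
proof -
  define V where "V = constrained_sol Q (H ** B) (transpose (Q ** A) *v w)"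
  have V: "(H ** B) *v V = transpose (Q ** A) *v w"
    unfolding V_def constrained_sol_def using theI'[OF L_ex1_transpose_S[of w]] by blast
  have "w \<bullet> ((Q ** A) *v V) = (transpose (Q ** A) *v w) \<bullet> V"
    by (simp add: dot_lmul_matrix transpose_matrix_vector)
  also have "\<dots> = (H *v (B *v V)) \<bullet> V"
    using V by (simp flip: matrix_vector_mul_assoc)
  also have "\<dots> = (H *v V) \<bullet> (B *v V)"
    using dot_lmul_matrix[of "B *v V" H V] H_sym by (metis inner_commute transpose_matrix_vector)
  finally show ?thesis
    using HB_nonneg V_def by simp
qed

end


section \<open>The limiting system in diffusive form\<close>

text \<open>By the chain rule the derivative of \<open>w \<mapsto> \<Phi>(E w)\<close> in the direction \<open>z\<close> is
  \<open>\<nu> Q D z = \<nu> z\<close>: the multiplier \<open>\<nu>\<close> is the entropy variable of the reduced system.\<close>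
lemma grad_comp_section:
  fixes \<Phi> :: "real^'N \<Rightarrow> real" and E :: "real^'n \<Rightarrow> real^'N" and Q :: "real^'N^'n"
  assumes E: "(E has_derivative (\<lambda>z. D *v z)) (at u)" and QD: "\<And>z. Q *v (D *v z) = z"
    and "\<Phi> differentiable (at (E u))" and "grad \<Phi> (E u) = \<nu> v* Q"
  shows "grad (\<lambda>w. \<Phi> (E w)) u = \<nu>"
proof -
  have "(\<Phi> has_derivative (\<lambda>h. h \<bullet> grad \<Phi> (E u))) (at (E u))"
    using differentiable_GDERIV_grad[OF assms(3)] unfolding gderiv_def .
  from has_derivative_compose[OF E this]
  have "((\<lambda>w. \<Phi> (E w)) has_derivative (\<lambda>z. z \<bullet> \<nu>)) (at u)"
    by (simp add: assms(4) dot_lmul_matrix QD inner_commute[of _ "_ v* _"] inner_commute[of _ \<nu>])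
  then show ?thesis
    by (intro GDERIV_grad_eq) (simp add: gderiv_def)
qed

theorem theorem2p1:
  fixes \<Omega> :: "(real^'N) set" and \<omega> :: "(real^'n) set"
    and F R :: "real^'N \<Rightarrow> real^'N"
    and Q :: "real^'N^'n"
    and E :: "real^'n \<Rightarrow> real^'N"
    and \<Phi> \<Psi> :: "real^'N \<Rightarrow> real"
    and \<nu> :: "real^'N \<Rightarrow> real^'n"
  assumes dims: "CARD('n) < CARD('N)"
    and Omega: "convex \<Omega>" "open \<Omega>"
    and regular: "C1_on \<Omega> F" "C1_on \<Omega> R"
    and hyperbolic: "\<forall>U\<in>\<Omega>. has_real_eigenbasis (jacobian F (at U))"
    and Q_rank: "rank Q = CARD('n)"
    and QR: "\<forall>U\<in>\<Omega>. Q *v R U = 0"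
    and omega: "\<omega> = (\<lambda>U. Q *v U) ` \<Omega>"
    and equilibria: "\<forall>u\<in>\<omega>. E u \<in> \<Omega> \<and> Q *v E u = u \<and> R (E u) = 0"
    and equilibria_unique: "\<forall>u\<in>\<omega>. \<forall>U\<in>\<Omega>. Q *v U = u \<and> R U = 0 \<longrightarrow> U = E u"
    and kernel_dim: "\<forall>u\<in>\<omega>. dim {V. jacobian R (at (E u)) *v V = 0} = CARD('n)"
    and kernel_image: "\<forall>u\<in>\<omega>. {V. jacobian R (at (E u)) *v V = 0}
                         \<inter> range (\<lambda>V. jacobian R (at (E u)) *v V) = {0}"
    and QF: "\<forall>u\<in>\<omega>. Q *v F (E u) = 0"
    and entropy_regular: "\<forall>U\<in>\<Omega>. \<Phi> differentiable (at U)" "C1_on \<Omega> (grad \<Phi>)"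
      "\<forall>U\<in>\<Omega>. \<Psi> differentiable (at U)"
    and entropy_symmetric: "\<forall>U\<in>\<Omega>. transpose (hessian \<Phi> U ** jacobian F (at U))
                              = hessian \<Phi> U ** jacobian F (at U)"
    and entropy_flux: "\<forall>U\<in>\<Omega>. grad \<Phi> U v* jacobian F (at U) = grad \<Psi> U"
    and entropy_convex: "\<forall>U\<in>\<Omega>. \<forall>V. V \<noteq> 0 \<longrightarrow> V \<bullet> (hessian \<Phi> U *v V) > 0"
    and entropy_relaxation: "\<forall>U\<in>\<Omega>. grad \<Phi> U \<bullet> R U \<ge> 0"
    and entropy_equilibrium: "\<forall>U\<in>E ` \<omega>. grad \<Phi> U = \<nu> U v* Q"
  shows
    "(\<forall>u\<in>\<omega>.
       (\<forall>b. \<exists>\<^sub>\<le>\<^sub>1V. L_mat \<Phi> R E u *v V = b \<and> Q *v V = 0) \<and>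
       (\<forall>b. (\<exists>!V. L_mat \<Phi> R E u *v V = b \<and> Q *v V = 0)
              \<longleftrightarrow> b \<in> (\<lambda>c. hessian \<Phi> (E u) *v c) ` {c. Q *v c = 0}) \<and>
       (\<forall>w. \<exists>!V. L_mat \<Phi> R E u *v V = transpose (S_mat Q F E u) *v w \<and> Q *v V = 0)) \<and>
     (\<forall>(v :: real \<Rightarrow> real^'n) x. range v \<subseteq> \<omega> \<and> v differentiable (at x) \<longrightarrow>
       (\<lambda>y. F (E (v y))) differentiable (at x) \<and>
       (\<lambda>y. grad (\<lambda>w. \<Phi> (E w)) (v y)) differentiable (at x) \<and>
       (\<exists>!V. jacobian R (at (E (v x))) *v V = - dx_flux F E v x \<and> Q *v V = 0) \<and>
       - ((Q ** jacobian F (at (E (v x)))) *v U1 Q F R E v x) = diffusive_flux Q F R E \<Phi> v x \<and>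
       dx_entropy_grad \<Phi> E v x \<bullet> diffusive_flux Q F R E \<Phi> v x \<ge> 0) \<and>
     (\<forall>u. limiting_system \<omega> Q F R E u \<longleftrightarrow> diffusive_system \<omega> Q F R E \<Phi> u)"
proof -
  have surj_Q: "surj ((*v) Q)"
    using Q_rank full_rank_surjective by blast
  obtain P :: "real^'n^'N" where QP: "Q ** P = mat 1"
    using surj_Q matrix_right_invertible_surjective by blast
  have "open \<omega>"
    unfolding omega using Omega(2) surj_Q
    by (intro open_surjective_linear_image matrix_vector_mul_linear) auto
  have H_deriv: "(grad \<Phi> has_derivative (\<lambda>h. hessian \<Phi> U *v h)) (at U)" if "U \<in> \<Omega>" for U
    unfolding hessian_def using C1_on_has_derivative[OF entropy_regular(2) that] .
  have QB: "Q *v (jacobian R (at U) *v V) = 0" if "U \<in> \<Omega>" for U V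
    using has_derivative_unique_on_open[OF
        has_derivative_matrix_comp[where M = Q, OF C1_on_has_derivative[OF regular(2) that]]
        has_derivative_const[of 0] Omega(2) that] QR
    by simp
  have range_B: "range ((*v) (jacobian R (at (E u)))) = {c. Q *v c = 0}" if "u \<in> \<omega>" for u
    using range_eq_ker_of_dim[OF surj_Q] QB equilibria kernel_dim that by blast
  have B_ker_Q: "\<exists>!V. jacobian R (at (E u)) *v V = c \<and> Q *v V = 0" if "u \<in> \<omega>" "Q *v c = 0" for u c
    using ex1_ker_solution[OF range_B] kernel_image that by blast

  have "\<exists>D. (E has_derivative (\<lambda>z. D *v z)) (at u) \<and> (\<forall>z. Q *v (D *v z) = z)" if u: "u \<in> \<omega>" for u
  proof -
    have "E differentiable (at (Q *v E u))"
    proof (rule zero_set_section_differentiable[OF Omega(2) regular(2) QP])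
      show "V = 0" if "jacobian R (at (E u)) *v V = 0" "Q *v V = 0" for V
        using B_ker_Q[OF u, of 0] that by (metis matrix_vector_mult_0_right)
      show "U = E (Q *v U)" if "U \<in> \<Omega>" "R U = 0" for U
        using equilibria_unique omega that by blast
    qed (use u equilibria QR QB in auto)
    then have "(E has_derivative (\<lambda>z. jacobian E (at u) *v z)) (at u)"
      using equilibria u by (simp add: jacobian_works)
    moreover have "Q *v (jacobian E (at u) *v z) = z" for z
      using has_derivative_unique_on_open[OF has_derivative_matrix_comp[OF calculation]
          has_derivative_ident \<open>open \<omega>\<close> u] equilibria by blast
    ultimately show ?thesis
      by blast
  qed
  then obtain D where D: "\<And>u. u \<in> \<omega> \<Longrightarrow> (E has_derivative (\<lambda>z. D u *v z)) (at u)"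
    and QD: "\<And>u z. u \<in> \<omega> \<Longrightarrow> Q *v (D u *v z) = z"
    by metis

  \<comment> \<open>\<open>g = \<nu> \<circ> \<E>\<close> on \<open>\<omega>\<close>, but \<open>\<nu>\<close> is an arbitrary function; that \<open>g\<close> is differentiable is seen from
    \<open>g(u) = P\<^sup>T D\<^sub>U\<Phi>(\<E>(u))\<close>, where \<open>P\<close> is a right inverse of \<open>Q\<close>.\<close>
  define g where "g = grad (\<lambda>w. \<Phi> (E w))"
  define G where "G u = transpose P ** (hessian \<Phi> (E u) ** D u)" for u
  have g_nu: "g u = \<nu> (E u)" if "u \<in> \<omega>" for u
    unfolding g_def using that equilibria entropy_regular(1) entropy_equilibrium
    by (intro grad_comp_section[OF D QD]) auto
  have gQ: "grad \<Phi> (E u) = transpose Q *v g u" if "u \<in> \<omega>" for u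
    using entropy_equilibrium that by (simp add: g_nu)
  have gP: "transpose P *v grad \<Phi> (E u) = g u" if "u \<in> \<omega>" for u
    using that unfolding gQ[OF that] matrix_vector_mul_assoc
    by (simp add: QP transpose_mat flip: matrix_transpose_mul del: transpose_matrix_vector)
  have dE: "((\<lambda>w. grad \<Phi> (E w)) has_derivative (\<lambda>z. hessian \<Phi> (E u) *v (D u *v z))) (at u)"
    if "u \<in> \<omega>" for u
    using has_derivative_compose[OF D[OF that] H_deriv] equilibria that by blast
  have dg: "(g has_derivative (\<lambda>z. G u *v z)) (at u)" if "u \<in> \<omega>" for u
    using has_derivative_transform_within_open[OF has_derivative_matrix_comp[OF dE[OF that]]
        \<open>open \<omega>\<close> that gP]
    by (simp only: G_def matrix_vector_mul_assoc)
  have dF: "((\<lambda>w. F (E w)) has_derivative (\<lambda>z. (jacobian F (at (E u)) ** D u) *v z)) (at u)"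
    if "u \<in> \<omega>" for u
    using has_derivative_compose[OF D[OF that] C1_on_has_derivative[OF regular(1)]] equilibria that
    by (simp flip: matrix_vector_mul_assoc)

  have lin: "linearized_relaxation Q (jacobian F (at (E u))) (jacobian R (at (E u)))
      (hessian \<Phi> (E u)) (D u) (G u)" if u: "u \<in> \<omega>" for u
  proof
    have U: "E u \<in> \<Omega>" "R (E u) = 0"
      using equilibria u by auto
    have sym: "(hessian \<Phi> (E u) *v h) \<bullet> k = h \<bullet> (hessian \<Phi> (E u) *v k)" for h k
      using second_derivative_symmetric[OF Omega(2) U(1) differentiable_GDERIV_grad H_deriv[OF U(1)]]
        entropy_regular(1) by blast
    have "h v* hessian \<Phi> (E u) = hessian \<Phi> (E u) *v h" for h
      using vector_eq_rdot[of "h v* hessian \<Phi> (E u)" "hessian \<Phi> (E u) *v h"]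
      by (simp add: dot_lmul_matrix sym)
    then show "transpose (hessian \<Phi> (E u)) = hessian \<Phi> (E u)"
      by (simp add: matrix_eq)
    show "V \<bullet> (hessian \<Phi> (E u) *v V) > 0" if "V \<noteq> 0" for V
      using entropy_convex U(1) that by blast
    show "transpose (hessian \<Phi> (E u) ** jacobian F (at (E u))) = hessian \<Phi> (E u) ** jacobian F (at (E u))"
      using entropy_symmetric U(1) by blast
    show "Q *v (jacobian R (at (E u)) *v V) = 0" for V
      using QB U(1) by blast
    show "\<exists>!V. jacobian R (at (E u)) *v V = c \<and> Q *v V = 0" if "Q *v c = 0" for c
      using B_ker_Q u that by blast
    show "(hessian \<Phi> (E u) *v V) \<bullet> (jacobian R (at (E u)) *v V) \<ge> 0" for V
    proof (rule derivatives_inner_nonneg_at_zero[where p' = "(*v) (hessian \<Phi> (E u))"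
          and r' = "(*v) (jacobian R (at (E u)))", OF Omega(2) U(1) H_deriv[OF U(1)]
          C1_on_has_derivative[OF regular(2) U(1)] U(2)])
      fix U assume "U \<in> \<Omega>"
      have "grad \<Phi> (E u) \<bullet> R U = \<nu> (E u) \<bullet> (Q *v R U)"
        using entropy_equilibrium u by (simp add: dot_lmul_matrix)
      also have "\<dots> = 0"
        using QR \<open>U \<in> \<Omega>\<close> by simp
      finally show "(grad \<Phi> U - grad \<Phi> (E u)) \<bullet> R U \<ge> 0"
        using entropy_relaxation \<open>U \<in> \<Omega>\<close> by (simp add: inner_diff_left)
    qed
    show "Q *v (D u *v z) = z" for z
      using QD u by blast
    show "hessian \<Phi> (E u) *v (D u *v z) = transpose Q *v (G u *v z)" for z
      using has_derivative_unique_on_open[OF dE[OF u] has_derivative_matrix_comp[OF dg[OF u]]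
          \<open>open \<omega>\<close> u gQ] .
    show "Q *v (jacobian F (at (E u)) *v (D u *v z)) = 0" for z
      using has_derivative_unique_on_open[OF has_derivative_matrix_comp[where M = Q, OF dF[OF u]]
          has_derivative_const[of 0] \<open>open \<omega>\<close> u] QF
      by (simp flip: matrix_vector_mul_assoc)
  qed

  have pointwise: "(\<forall>b. \<exists>\<^sub>\<le>\<^sub>1V. L_mat \<Phi> R E u *v V = b \<and> Q *v V = 0) \<and>
       (\<forall>b. (\<exists>!V. L_mat \<Phi> R E u *v V = b \<and> Q *v V = 0)
              \<longleftrightarrow> b \<in> (\<lambda>c. hessian \<Phi> (E u) *v c) ` {c. Q *v c = 0}) \<and>
       (\<forall>w. \<exists>!V. L_mat \<Phi> R E u *v V = transpose (S_mat Q F E u) *v w \<and> Q *v V = 0)"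
    if "u \<in> \<omega>" for u
    unfolding L_mat_def S_mat_def
    using linearized_relaxation.L_solution_unique[OF lin[OF that]]
      linearized_relaxation.L_ex1_iff[OF lin[OF that]]
      linearized_relaxation.L_ex1_transpose_S[OF lin[OF that]]
    by (intro conjI allI)

  have along: "(\<lambda>y. F (E (v y))) differentiable (at x) \<and>
       (\<lambda>y. g (v y)) differentiable (at x) \<and>
       (\<exists>!V. jacobian R (at (E (v x))) *v V = - dx_flux F E v x \<and> Q *v V = 0) \<and>
       - ((Q ** jacobian F (at (E (v x)))) *v U1 Q F R E v x) = diffusive_flux Q F R E \<Phi> v x \<and>
       dx_entropy_grad \<Phi> E v x \<bullet> diffusive_flux Q F R E \<Phi> v x \<ge> 0"
    if "range v \<subseteq> \<omega>" "v differentiable (at x)" for v :: "real \<Rightarrow> real^'n" and x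
  proof -
    let ?A = "jacobian F (at (E (v x)))" and ?v' = "vector_derivative v (at x)"
    have vx: "v x \<in> \<omega>"
      using that(1) by blast
    interpret linearized_relaxation Q ?A "jacobian R (at (E (v x)))" "hessian \<Phi> (E (v x))"
      "D (v x)" "G (v x)"
      using lin[OF vx] .
    have v': "(v has_vector_derivative ?v') (at x)"
      using that(2) vector_derivative_works by blast
    note F' = has_vector_derivative_along_curve[OF v' dF[OF vx]]
    note g' = has_vector_derivative_along_curve[OF v' dg[OF vx]]
    have flux: "dx_flux F E v x = ?A *v (D (v x) *v ?v')"
      unfolding dx_flux_def using vector_derivative_at[OF F'] by (simp flip: matrix_vector_mul_assoc)
    have egrad: "dx_entropy_grad \<Phi> E v x = G (v x) *v ?v'"
      unfolding dx_entropy_grad_def using vector_derivative_at[OF g'] by (simp add: g_def)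
    have "Q *v (- dx_flux F E v x) = 0"
      by (simp add: flux QAD linear_neg[OF matrix_vector_mul_linear])
    then have ex1: "\<exists>!V. jacobian R (at (E (v x))) *v V = - dx_flux F E v x \<and> Q *v V = 0"
      by (rule B_ker_Q)
    have "diffusive_flux Q F R E \<Phi> v x = (Q ** ?A) *v (- U1 Q F R E v x)"
      unfolding diffusive_flux_def L_inv_def L_mat_def S_mat_def U1_def egrad flux constrained_sol_L ..
    then have eq: "- ((Q ** ?A) *v U1 Q F R E v x) = diffusive_flux Q F R E \<Phi> v x"
      by (simp add: linear_neg[OF matrix_vector_mul_linear])
    have "dx_entropy_grad \<Phi> E v x \<bullet> diffusive_flux Q F R E \<Phi> v x \<ge> 0"
      unfolding diffusive_flux_def L_inv_def L_mat_def S_mat_def by (rule dissipation_nonneg)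
    moreover have "(\<lambda>y. F (E (v y))) differentiable (at x)" "(\<lambda>y. g (v y)) differentiable (at x)"
      using differentiableI[OF F'[unfolded has_vector_derivative_def]]
        differentiableI[OF g'[unfolded has_vector_derivative_def]] by simp_all
    ultimately show ?thesis
      using ex1 eq by (intro conjI)
  qed

  have equiv: "limiting_system \<omega> Q F R E u \<longleftrightarrow> diffusive_system \<omega> Q F R E \<Phi> u" for u
  proof -
    have eq: "diffusive_flux Q F R E \<Phi> (u t)
        = (\<lambda>y. - ((Q ** jacobian F (at (E (u t y)))) *v U1 Q F R E (u t) y))"
      if "\<forall>x. u t x \<in> \<omega> \<and> u t differentiable (at x)" for t
    proof
      fix y
      have "range (u t) \<subseteq> \<omega>" "u t differentiable (at y)"
        using that by auto
      then show "diffusive_flux Q F R E \<Phi> (u t) y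
          = - ((Q ** jacobian F (at (E (u t y)))) *v U1 Q F R E (u t) y)"
        using along[of "u t" y] by presburger
    qed
    have flip: "(\<exists>d. (f has_vector_derivative - d) (at t) \<and> (h has_vector_derivative d) (at x)) \<longleftrightarrow>
        (\<exists>d. (f has_vector_derivative d) (at t) \<and> ((\<lambda>y. - h y) has_vector_derivative d) (at x))"
      for f h :: "real \<Rightarrow> real^'n" and t x
    proof -
      have "((\<lambda>y. - h y) has_vector_derivative - d) (at x) \<longleftrightarrow> (h has_vector_derivative d) (at x)" for d
        using has_vector_derivative_minus[of h d "at x"]
          has_vector_derivative_minus[of "\<lambda>y. - h y" "- d" "at x"] by auto
      then show ?thesis
        by (metis minus_minus)
    qed
    have "(\<forall>x. u t x \<in> \<omega> \<and> u t differentiable (at x) \<and>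
        (\<exists>d. ((\<lambda>s. u s x) has_vector_derivative - d) (at t) \<and>
          ((\<lambda>y. (Q ** jacobian F (at (E (u t y)))) *v U1 Q F R E (u t) y) has_vector_derivative d) (at x)))
      \<longleftrightarrow> (\<forall>x. u t x \<in> \<omega> \<and> u t differentiable (at x) \<and>
        (\<exists>d. ((\<lambda>s. u s x) has_vector_derivative d) (at t) \<and>
          (diffusive_flux Q F R E \<Phi> (u t) has_vector_derivative d) (at x)))" for t
    proof (cases "\<forall>x. u t x \<in> \<omega> \<and> u t differentiable (at x)")
      case True
      show ?thesis
        unfolding eq[OF True] flip ..
    next
      case False
      then show ?thesis
        by blast
    qed
    then show ?thesis
      unfolding limiting_system_def diffusive_system_def by simp
  qed
  show ?thesis
    by (rule conjI[OF ballI[OF pointwise] conjI[OF allI[OF allI[OF impI]] allI[OF equiv]]])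
      (assumption | elim conjE, rule along[unfolded g_def])+
qed

end
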